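(* Let $R$ be an uncountable unique factorization domain. Then $R$ is submaximal.
   Context: All rings are commutative with $1\neq 0$, and a subring of a ring contains the identity of that ring. A maximal subring of $R$ is a proper subring $S\subsetneq R$ such that there is no subring strictly between $S$ and $R$; $R$ is called submaximal if it has at least one maximal subring. *)

theory Defs
  imports "HOL-Algebra.Subrings" "HOL-Algebra.Ring_Divisibility" "HOL-Library.Countable_Set"
begin

definition maximal_subring :: "'a set \<Rightarrow> ('a, 'b) ring_scheme \<Rightarrow> bool" where
  "maximal_subring S R \<longleftrightarrow>
     subring S R \<and> S \<subset> carrier R \<and> \<not> (\<exists>T. subring T R \<and> S \<subset> T \<and> T \<subset> carrier R)"

definition submaximal :: "('a, 'b) ring_scheme \<Rightarrow> bool" where
  "submaximal R \<longleftrightarrow> (\<exists>S. maximal_subring S R)"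

end

theory Submission
  imports Defs "HOL-Algebra.Finite_Extensions"
begin

text \<open>
  The key fact is that a domain \<open>R\<close> with a unit \<open>u\<close> transcendental over some subring is submaximal:
  take a subring \<open>D\<close> maximal with \<open>u\<close> transcendental over \<open>D\<close>, so that \<open>R\<close> is algebraic over \<open>D[u]\<close>,
  and then a subring \<open>A\<close> containing \<open>D[u]\<close> maximal with \<open>D \<inter> u A = 0\<close>. This \<open>A\<close> behaves like the
  trace on \<open>R\<close> of a rank one valuation ring centred at \<open>u\<close>: it does not contain \<open>1/u\<close>, but
  \<open>R = A[1/u]\<close>. Hence a subring containing \<open>A\<close> that is maximal without \<open>1/u\<close> is a maximal subring.

  Let \<open>R\<close> be an uncountable UFD and \<open>Z\<close> a countable subring. If there are uncountably many units, one
  of them is transcendental over \<open>Z\<close>. Otherwise every nonzero element has only countably many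
  divisors. So there is a nonzero \<open>x\<close> dividing no nonzero element of \<open>Z\<close>, which makes it transcendental
  over \<open>Z\<close>, and then a \<open>y\<close> such that \<open>1 - x y\<close> is nonzero and divides no nonzero element of \<open>Z[x]\<close>.
  Some prime factor \<open>p\<close> of \<open>1 - x y\<close> divides no nonzero element of \<open>Z[x]\<close>, so in the domain \<open>R/(p)\<close>
  the image of \<open>x\<close> is a unit transcendental over the image of \<open>Z\<close>, and maximal subrings of \<open>R/(p)\<close>
  pull back to \<open>R\<close>.
\<close>

subsection \<open>Existence and inverse images of maximal subrings\<close>

lemma (in ring) chain_Union_is_subring:
  assumes "C \<noteq> {}" "subset.chain \<A> C" "\<And>A. A \<in> \<A> \<Longrightarrow> subring A R"
  shows "subring (\<Union>C) R"
proof (rule subringI)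
  have sub: "subring A R" if "A \<in> C" for A
    using assms(2,3) that by (auto simp: subset.chain_def)
  show "\<Union>C \<subseteq> carrier R" "\<one> \<in> \<Union>C"
    using assms(1) subringE(1,3)[OF sub] by auto
  show "\<ominus> h \<in> \<Union>C" if "h \<in> \<Union>C" for h
    using subringE(5)[OF sub] that by auto
  fix h1 h2 assume "h1 \<in> \<Union>C" "h2 \<in> \<Union>C"
  then obtain A where A: "A \<in> C" "{h1, h2} \<subseteq> A"
    using finite_subset_Union_chain[OF _ _ assms(1,2), of "{h1, h2}"] by auto
  then show "h1 \<otimes> h2 \<in> \<Union>C" "h1 \<oplus> h2 \<in> \<Union>C"
    using subringE(6,7)[OF sub[OF A(1)], of h1 h2] by auto
qed

text \<open>Zorn's lemma yields a subring maximal among those that contain \<open>A\<close> and miss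
  \<open>x\<close>; every strictly larger subring contains \<open>x\<close>, hence is everything by
  \<open>gen\<close>.\<close>

lemma (in ring) submaximalI:
  assumes "subring A R" "x \<in> carrier R" "x \<notin> A"
    and gen: "\<And>T. \<lbrakk> subring T R; A \<subseteq> T; x \<in> T \<rbrakk> \<Longrightarrow> T = carrier R"
  shows "submaximal R"
proof -
  let ?F = "{T. subring T R \<and> A \<subseteq> T \<and> x \<notin> T}"
  have "\<exists>M\<in>?F. \<forall>T\<in>?F. M \<subseteq> T \<longrightarrow> T = M"
  proof (rule subset_Zorn_nonempty)
    show "?F \<noteq> {}" using assms(1,3) by blast
  next
    fix C assume C: "C \<noteq> {}" "subset.chain ?F C"
    then have "C \<subseteq> ?F" by (simp add: subset.chain_def)
    then show "\<Union>C \<in> ?F"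
      using chain_Union_is_subring[OF C] C(1) by blast
  qed
  then obtain M where M: "subring M R" "A \<subseteq> M" "x \<notin> M"
    and max: "\<forall>T\<in>?F. M \<subseteq> T \<longrightarrow> T = M" by auto
  have "M \<subset> carrier R"
    using M(1,3) subringE(1) assms(2) by auto
  moreover have "\<not> (\<exists>T. subring T R \<and> M \<subset> T \<and> T \<subset> carrier R)"
  proof (intro notI, elim exE conjE)
    fix T assume T: "subring T R" "M \<subset> T" "T \<subset> carrier R"
    then have "x \<in> T" using max M(2) by auto
    then show False using gen[OF T(1)] T M(2) by auto
  qed
  ultimately show ?thesis
    using M(1) unfolding submaximal_def maximal_subring_def by (intro exI conjI)
qed

text \<open>Correspondence principle: the inverse image of a maximal subring contains the kernel, so
  the subrings above it are determined by their images.\<close>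

lemma (in ring_hom_ring) submaximal_vimage:
  assumes surj: "h ` carrier R = carrier S" and "submaximal S"
  shows "submaximal R"
proof -
  obtain M where M: "subring M S" "M \<subset> carrier S"
      "\<not> (\<exists>T. subring T S \<and> M \<subset> T \<and> T \<subset> carrier S)"
    using assms(2) unfolding submaximal_def maximal_subring_def by (elim exE conjE)
  define N where "N = {r \<in> carrier R. h r \<in> M}"
  have hN: "h ` N = M"
  proof
    show "M \<subseteq> h ` N"
    proof
      fix m assume m: "m \<in> M"
      then have "m \<in> h ` carrier R" using M(2) surj by auto
      then show "m \<in> h ` N" using m by (auto simp: N_def)
    qed
  qed (auto simp: N_def)
  have N: "subring N R"
    by (rule R.subringI) (simp_all add: N_def subringE[OF M(1)] subset_eq)
  have "\<not> (N \<subset> T \<and> T \<subset> carrier R)" if T: "subring T R" for T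
  proof
    assume NT: "N \<subset> T \<and> T \<subset> carrier R"
    have pre: "r \<in> T" if r: "r \<in> carrier R" "h r \<in> h ` T" for r
    proof -
      obtain t where t: "t \<in> T" "h r = h t" using r by blast
      then have tc: "t \<in> carrier R" using NT by blast
      have "h (r \<ominus> t) = \<zero>\<^bsub>S\<^esub>"
        using r tc t(2) 
        by (simp add: R.minus_eq S.r_neg)
      then have "r \<ominus> t \<in> N"
        using r tc subringE(2)[OF M(1)] by (auto simp: N_def)
      then have "(r \<ominus> t) \<oplus> t \<in> T"
        using NT t(1) subringE(7)[OF T] by blast
      then show ?thesis using r tc by (simp add: R.minus_eq R.a_assoc R.l_neg)
    qed
    have "M \<subset> h ` T"
    proof -
      obtain t where "t \<in> T" "t \<notin> N" using NT by blast
      then have "h t \<notin> M" using NT by (auto simp: N_def)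
      then show ?thesis using \<open>t \<in> T\<close> hN NT by blast
    qed
    moreover have "h ` T \<subset> carrier S"
    proof -
      obtain r where "r \<in> carrier R" "r \<notin> T" using NT by blast
      then have "h r \<notin> h ` T" "h r \<in> carrier S" using pre surj by blast+
      then show ?thesis using NT surj by blast
    qed
    ultimately show False
      using M(3) img_is_subring[OF T] by blast
  qed
  moreover have "N \<subset> carrier R"
    using hN surj M(2) by (auto simp: N_def)
  ultimately show ?thesis
    using N unfolding submaximal_def maximal_subring_def by blast
qed

subsection \<open>Transcendental units\<close>

text \<open>Values at \<open>x\<close> of the polynomials over \<open>A\<close> of degree strictly less than \<open>n\<close>.\<close>

primrec (in ring) polyvals :: "'a set \<Rightarrow> 'a \<Rightarrow> nat \<Rightarrow> 'a set" where
  "polyvals A x 0 = {\<zero>}"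
| "polyvals A x (Suc n) = {v \<otimes> x \<oplus> a | v a. v \<in> polyvals A x n \<and> a \<in> A}"

section \<open>Polynomial values filtered by degree\<close>

context cring
begin

lemma polyvals_in_carrier:
  assumes "A \<subseteq> carrier R" "x \<in> carrier R"
  shows "polyvals A x n \<subseteq> carrier R"
  by (induction n) (use assms in auto)

lemma polyvals_zero:
  assumes "subring A R" "x \<in> carrier R"
  shows "\<zero> \<in> polyvals A x n"
proof (induction n)
  case (Suc n)
  have "\<zero> = \<zero> \<otimes> x \<oplus> \<zero>" using assms by simp
  then show ?case using Suc subringE(2)[OF assms(1)] by auto
qed simp

lemma polyvals_Suc_mono:
  assumes "subring A R" "x \<in> carrier R"
  shows "polyvals A x n \<subseteq> polyvals A x (Suc n)"
proof (induction n)
  case 0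
  show ?case using polyvals_zero[OF assms, of 1] by simp
next
  case (Suc n)
  show ?case
  proof
    fix w assume "w \<in> polyvals A x (Suc n)"
    then obtain v a where "w = v \<otimes> x \<oplus> a" "v \<in> polyvals A x n" "a \<in> A" by auto
    then show "w \<in> polyvals A x (Suc (Suc n))"
      using Suc polyvals.simps(2)[of A x "Suc n"] by blast
  qed
qed

lemma polyvals_mono:
  assumes "subring A R" "x \<in> carrier R" "m \<le> n"
  shows "polyvals A x m \<subseteq> polyvals A x n"
  using assms(3) by (rule lift_Suc_mono_le[of "polyvals A x", OF polyvals_Suc_mono[OF assms(1,2)]])

lemma polyvals_add:
  assumes A: "subring A R" "x \<in> carrier R"
  shows "v \<in> polyvals A x n \<Longrightarrow> w \<in> polyvals A x n \<Longrightarrow> v \<oplus> w \<in> polyvals A x n"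
proof (induction n arbitrary: v w)
  case (Suc n)
  obtain v' a w' b where *: "v = v' \<otimes> x \<oplus> a" "w = w' \<otimes> x \<oplus> b"
    "v' \<in> polyvals A x n" "w' \<in> polyvals A x n" "a \<in> A" "b \<in> A"
    using Suc.prems by auto
  have "v' \<in> carrier R" "w' \<in> carrier R" "a \<in> carrier R" "b \<in> carrier R"
    using * polyvals_in_carrier[OF subringE(1)[OF A(1)] A(2)] subringE(1)[OF A(1)] by auto
  then have "v \<oplus> w = (v' \<oplus> w') \<otimes> x \<oplus> (a \<oplus> b)"
    unfolding *(1,2) using A(2) by algebra
  then show ?case
    using Suc.IH[OF *(3,4)] subringE(7)[OF A(1) *(5,6)] by auto
qed simp

lemma polyvals_scale:
  assumes A: "subring A R" "x \<in> carrier R" and c: "c \<in> A"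
  shows "v \<in> polyvals A x n \<Longrightarrow> c \<otimes> v \<in> polyvals A x n"
proof (induction n arbitrary: v)
  case 0
  then show ?case using c subringE(1)[OF A(1)] by auto
next
  case (Suc n)
  obtain v' a where *: "v = v' \<otimes> x \<oplus> a" "v' \<in> polyvals A x n" "a \<in> A"
    using Suc.prems by auto
  have "v' \<in> carrier R" "a \<in> carrier R" "c \<in> carrier R"
    using * c polyvals_in_carrier[OF subringE(1)[OF A(1)] A(2)] subringE(1)[OF A(1)] by auto
  then have "c \<otimes> v = (c \<otimes> v') \<otimes> x \<oplus> (c \<otimes> a)"
    unfolding *(1) using A(2) by algebra
  then show ?case
    using Suc.IH[OF *(2)] subringE(6)[OF A(1) c *(3)] by auto
qed

lemma polyvals_uminus:
  assumes A: "subring A R" "x \<in> carrier R" and v: "v \<in> polyvals A x n"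
  shows "\<ominus> v \<in> polyvals A x n"
proof -
  have "v \<in> carrier R" using v polyvals_in_carrier[OF subringE(1)[OF A(1)] A(2)] by auto
  then have "\<ominus> v = (\<ominus> \<one>) \<otimes> v" by algebra
  then show ?thesis
    using polyvals_scale[OF A subringE(5)[OF A(1) subringE(3)[OF A(1)]] v] by simp
qed

lemma polyvals_minus:
  assumes A: "subring A R" "x \<in> carrier R"
    and "v \<in> polyvals A x n" "w \<in> polyvals A x n"
  shows "v \<ominus> w \<in> polyvals A x n"
  unfolding a_minus_def using polyvals_add[OF A] polyvals_uminus[OF A] assms(3,4) by blast

lemma polyvals_shift:
  assumes A: "subring A R" "x \<in> carrier R" and v: "v \<in> polyvals A x n"
  shows "v \<otimes> x [^] (k::nat) \<in> polyvals A x (n + k)"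
proof (induction k)
  case 0
  have "v \<in> carrier R" using v polyvals_in_carrier[OF subringE(1)[OF A(1)] A(2)] by blast
  then show ?case using v by simp
next
  case (Suc k)
  have "v \<in> carrier R" using v polyvals_in_carrier[OF subringE(1)[OF A(1)] A(2)] by auto
  then have "v \<otimes> x [^] Suc k = (v \<otimes> x [^] k) \<otimes> x \<oplus> \<zero>"
    using A(2) by (simp add: m_assoc)
  then show ?case using Suc subringE(2)[OF A(1)] by auto
qed

lemma polyvals_const:
  assumes A: "subring A R" "x \<in> carrier R" and "a \<in> A"
  shows "a \<in> polyvals A x (Suc n)"
proof -
  have "a = \<zero> \<otimes> x \<oplus> a" using assms subringE(1)[OF A(1)] by auto
  then show ?thesis using polyvals_zero[OF A, of n] assms(3) by auto
qed

text \<open>The recursion is Horner's scheme and exposes the constant term; this form exposes the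
  leading term, as needed for reducing one relation by another.\<close>

lemma polyvals_Suc_top:
  assumes A: "subring A R" "x \<in> carrier R"
  shows "v \<in> polyvals A x (Suc n) \<longleftrightarrow>
    (\<exists>w a. w \<in> polyvals A x n \<and> a \<in> A \<and> v = w \<oplus> a \<otimes> x [^] n)" (is "_ \<longleftrightarrow> ?R v n")
proof
  assume "?R v n"
  then obtain w a where *: "w \<in> polyvals A x n" "a \<in> A" "v = w \<oplus> a \<otimes> x [^] n" by blast
  have "a \<otimes> x [^] n \<in> polyvals A x (Suc n)"
    using polyvals_shift[OF A polyvals_const[OF A *(2), of 0], of n] by simp
  then show "v \<in> polyvals A x (Suc n)"
    using *(1,3) polyvals_add[OF A] polyvals_Suc_mono[OF A] by blast
next
  show "v \<in> polyvals A x (Suc n) \<Longrightarrow> ?R v n"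
  proof (induction n arbitrary: v)
    case 0
    then show ?case using A subringE(1)[OF A(1)] by fastforce
  next
    case (Suc n)
    obtain v' a where v: "v = v' \<otimes> x \<oplus> a" "v' \<in> polyvals A x (Suc n)" "a \<in> A"
      using Suc.prems unfolding polyvals.simps(2)[of A x "Suc n"] by blast
    obtain w b where w: "w \<in> polyvals A x n" "b \<in> A" "v' = w \<oplus> b \<otimes> x [^] n"
      using Suc.IH[OF v(2)] by blast
    have "w \<in> carrier R" "a \<in> carrier R" "b \<in> carrier R"
      using v w polyvals_in_carrier[OF subringE(1)[OF A(1)] A(2)] subringE(1)[OF A(1)] by auto
    moreover have "x [^] n \<in> carrier R" using A(2) by simp
    ultimately have "v = (w \<otimes> x \<oplus> a) \<oplus> b \<otimes> (x [^] n \<otimes> x)"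
      unfolding v(1) w(3) using A(2) by algebra
    then have "v = (w \<otimes> x \<oplus> a) \<oplus> b \<otimes> x [^] Suc n" by simp
    moreover have "w \<otimes> x \<oplus> a \<in> polyvals A x (Suc n)" using w(1) v(3) by auto
    ultimately show ?case using w(2) by blast
  qed
qed

text \<open>Termwise \<open>y^n a x^i = a y^(n-i) (y x)^i\<close>: the surplus powers of
  \<open>y\<close> go into the coefficients. This serves to strip a factor from a leading
  coefficient.\<close>

lemma polyvals_rescale:
  assumes A: "subring A R" "x \<in> carrier R" and y: "y \<in> A"
  shows "v \<in> polyvals A x (Suc n) \<Longrightarrow> y [^] n \<otimes> v \<in> polyvals A (y \<otimes> x) (Suc n)"
proof (induction n arbitrary: v)
  case 0
  have yc: "y \<in> carrier R" using y subringE(1)[OF A(1)] by auto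
  have v: "v \<in> A" "v \<in> carrier R" using 0 A subringE(1)[OF A(1)] by auto
  show ?case using v polyvals_const[OF A(1), of "y \<otimes> x" v 0] yc A(2) by simp
next
  case (Suc n)
  have yc: "y \<in> carrier R" using y subringE(1)[OF A(1)] by auto
  have A': "y \<otimes> x \<in> carrier R" using yc A(2) by simp
  obtain w a where w: "w \<in> polyvals A x (Suc n)" "a \<in> A" "v = w \<oplus> a \<otimes> x [^] Suc n"
    using polyvals_Suc_top[OF A] Suc.prems by blast
  have c: "w \<in> carrier R" "a \<in> carrier R" "y [^] n \<in> carrier R" "x [^] Suc n \<in> carrier R"
    using w polyvals_in_carrier[OF subringE(1)[OF A(1)] A(2)] subringE(1)[OF A(1)] yc A(2) by auto
  have "y [^] Suc n \<otimes> v = y \<otimes> (y [^] n \<otimes> w) \<oplus> a \<otimes> ((y [^] n \<otimes> y) \<otimes> x [^] Suc n)"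
    unfolding w(3) nat_pow_Suc[of y] using c yc by algebra
  also have "(y [^] n \<otimes> y) \<otimes> x [^] Suc n = (y \<otimes> x) [^] Suc n"
    using yc A(2) by (simp only: nat_pow_Suc[of y, symmetric] nat_pow_distrib)
  finally show ?case
    using polyvals_Suc_top[OF A(1) A', of _ "Suc n"]
      polyvals_scale[OF A(1) A' y Suc.IH[OF w(1)]] w(2) by blast
qed

lemma simple_extension_eq_polyvals:
  assumes A: "subring A R" "x \<in> carrier R"
  shows "simple_extension A x = (\<Union>n. polyvals A x n)"
proof
  show "simple_extension A x \<subseteq> (\<Union>n. polyvals A x n)"
  proof
    fix v assume "v \<in> simple_extension A x"
    then show "v \<in> (\<Union>n. polyvals A x n)"
    proof (induction rule: simple_extension.induct)
      case zero
      show ?case using polyvals.simps(1) by blast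
    next
      case (lin k1 k2)
      then obtain n where "k1 \<in> polyvals A x n" by blast
      then have "k1 \<otimes> x \<oplus> k2 \<in> polyvals A x (Suc n)" using lin(2) by auto
      then show ?case by blast
    qed
  qed
next
  have "polyvals A x n \<subseteq> simple_extension A x" for n
    by (induction n) (auto intro: simple_extension.intros)
  then show "(\<Union>n. polyvals A x n) \<subseteq> simple_extension A x" by blast
qed

end

text \<open>
  That is, \<open>D \<inter> u A = 0\<close>. For \<open>A = D[u]\<close> and \<open>u \<noteq> \<zero>\<close> in a domain this says that \<open>u\<close> is transcendental
  over \<open>D\<close>; unlike the usual formulation it makes sense for every ring \<open>A\<close> containing \<open>D[u]\<close>.
\<close>

definition (in ring) avoids :: "'a set \<Rightarrow> 'a \<Rightarrow> 'a set \<Rightarrow> bool" where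
  "avoids D u A \<longleftrightarrow> (\<forall>a\<in>A. u \<otimes> a \<in> D \<longrightarrow> u \<otimes> a = \<zero>)"

section \<open>Chevalley-style extension under the condition
  \<open>D \<inter> u A = 0\<close>\<close>

locale avoiding_extension = domain R for R (structure) +
  fixes D A :: "'a set" and u :: 'a
  assumes D: "subring D R" and A: "subring A R" and DA: "D \<subseteq> A" and uA: "u \<in> A"
    and avoids: "avoids D u A"
begin

text \<open>Avoidance embeds \<open>D\<close> into \<open>A/uA\<close>; this is the preimage in
  \<open>A\<close> of the nonzero elements of \<open>D\<close> there. For \<open>A = D[u]\<close> it
  consists of the polynomials in \<open>u\<close> with nonzero constant term.\<close>

definition nonvanishing :: "'a set" where
  "nonvanishing = {d \<oplus> u \<otimes> a | d a. d \<in> D \<and> d \<noteq> \<zero> \<and> a \<in> A}"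

lemma A_carrier: "a \<in> A \<Longrightarrow> a \<in> carrier R"
  using subringE(1)[OF A] by auto

lemma u_carrier: "u \<in> carrier R"
  using A_carrier uA .

lemma nonvanishing_subset: "nonvanishing \<subseteq> A"
  using DA uA subringE(6,7)[OF A] by (auto simp: nonvanishing_def)

lemma zero_notin_nonvanishing: "\<zero> \<notin> nonvanishing"
proof
  assume "\<zero> \<in> nonvanishing"
  then obtain d a where da: "d \<in> D" "d \<noteq> \<zero>" "a \<in> A" "\<zero> = d \<oplus> u \<otimes> a"
    unfolding nonvanishing_def by auto
  have c: "d \<in> carrier R" "a \<in> carrier R" using da DA A_carrier by auto
  \<comment> \<open>The vanishing term \<open>d \<oplus> u \<otimes> a\<close> is inserted in order
    to reach \<open>d = u \<otimes> (\<ominus> a)\<close>, contrary to avoidance.\<close>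
  have "u \<otimes> (\<ominus> a) = d \<oplus> u \<otimes> (\<ominus> a) \<ominus> (d \<oplus> u \<otimes> a) \<oplus> u \<otimes> a"
    using c u_carrier by algebra
  also have "\<dots> = d"
    unfolding da(4)[symmetric] using c u_carrier by algebra
  finally show False
    using avoids da(1,2) subringE(5)[OF A da(3)] unfolding avoids_def by auto
qed

lemma nonvanishing_mult:
  assumes "s \<in> nonvanishing" "t \<in> nonvanishing" shows "s \<otimes> t \<in> nonvanishing"
proof -
  obtain d a e b where *: "d \<in> D" "d \<noteq> \<zero>" "a \<in> A" "s = d \<oplus> u \<otimes> a"
    "e \<in> D" "e \<noteq> \<zero>" "b \<in> A" "t = e \<oplus> u \<otimes> b"
    using assms unfolding nonvanishing_def by auto
  have dA: "d \<in> A" "e \<in> A" using * DA by auto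
  have c: "d \<in> carrier R" "a \<in> carrier R" "e \<in> carrier R" "b \<in> carrier R"
    using * dA A_carrier by auto
  have "s \<otimes> t = d \<otimes> e \<oplus> u \<otimes> (d \<otimes> b \<oplus> a \<otimes> e \<oplus> u \<otimes> (a \<otimes> b))"
    unfolding *(4,8) using c u_carrier by algebra
  moreover have "d \<otimes> b \<oplus> a \<otimes> e \<oplus> u \<otimes> (a \<otimes> b) \<in> A"
    by (intro subringE(6,7)[OF A] dA uA *)
  moreover have "d \<otimes> e \<in> D" "d \<otimes> e \<noteq> \<zero>"
    using subringE(6)[OF D] * c integral[of d e] by auto
  ultimately show ?thesis unfolding nonvanishing_def by blast
qed

lemma nonvanishing_add:
  assumes "t \<in> nonvanishing" "b \<in> A" shows "t \<oplus> u \<otimes> b \<in> nonvanishing"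
proof -
  obtain d a where *: "d \<in> D" "d \<noteq> \<zero>" "a \<in> A" "t = d \<oplus> u \<otimes> a"
    using assms unfolding nonvanishing_def by auto
  have c: "d \<in> carrier R" "a \<in> carrier R" "b \<in> carrier R"
    using * assms DA A_carrier by auto
  have "t \<oplus> u \<otimes> b = d \<oplus> u \<otimes> (a \<oplus> b)"
    unfolding *(4) using c u_carrier by algebra
  then show ?thesis using * subringE(7)[OF A *(3) assms(2)] unfolding nonvanishing_def by blast
qed

text \<open>
  As in Chevalley's extension theorem, the two relations satisfied by \<open>\<beta>\<close> are reduced against each
  other: the one whose constant term is in the multiplicative set loses its top term by means of the
  other, or the other loses its constant term and is divided by \<open>\<beta>\<close>.
\<close>

lemma incompatible_relations:
  assumes \<beta>: "\<beta> \<in> carrier R" "\<beta> \<noteq> \<zero>"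
  shows "\<lbrakk> t \<in> nonvanishing; v \<in> polyvals A \<beta> m; t \<oplus> u \<otimes> (v \<otimes> \<beta>) = \<zero>;
    c \<in> nonvanishing; w \<in> polyvals A \<beta> n; c \<otimes> \<beta> [^] n \<oplus> w = \<zero> \<rbrakk> \<Longrightarrow> False"
proof (induction "m + n" arbitrary: m n t v c w rule: less_induct)
  case less
  note A\<beta> = A \<beta>(1)
  have pv: "p \<in> carrier R" if "p \<in> polyvals A \<beta> k" for p k
    using polyvals_in_carrier[OF subringE(1)[OF A] \<beta>(1)] that by auto
  have tc: "t \<in> A" "c \<in> A" using less.prems(1,4) nonvanishing_subset by auto
  have car: "t \<in> carrier R" "c \<in> carrier R" "v \<in> carrier R" "w \<in> carrier R" "u \<in> carrier R"
    using tc A_carrier less.prems(2,5) pv u_carrier by auto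
  \<comment> \<open>For \<open>m = 0\<close> the value \<open>v\<close> is zero, which leaves
    \<open>t = \<zero>\<close>; likewise \<open>n = 0\<close> leaves
    \<open>c = \<zero>\<close>.\<close>
  have "m \<noteq> 0"
    using less.prems(1-3) car \<beta>(1) zero_notin_nonvanishing by (intro notI) simp
  then obtain m' where m: "m = Suc m'" by (cases m) auto
  have "n \<noteq> 0"
    using less.prems(4-6) car zero_notin_nonvanishing by (intro notI) simp
  then obtain n' where n: "n = Suc n'" by (cases n) auto
  obtain w1 w0 where w: "w = w1 \<otimes> \<beta> \<oplus> w0" "w1 \<in> polyvals A \<beta> n'" "w0 \<in> A"
    using less.prems(5) unfolding n polyvals.simps(2) by auto
  have wcar: "w1 \<in> carrier R" "w0 \<in> carrier R" using w pv A_carrier by auto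
  show False
  proof (cases "n \<le> m")
    case True
    define k where "k = m - n"
    then have m'k: "m' = n' + k" "m = n + k" using True m n by auto
    obtain v' a where v: "v' \<in> polyvals A \<beta> m'" "a \<in> A" "v = v' \<oplus> a \<otimes> \<beta> [^] m'"
      using less.prems(2) polyvals_Suc_top[OF A\<beta>] unfolding m by blast
    have vcar: "v' \<in> carrier R" "a \<in> carrier R" using v pv A_carrier by auto
    \<comment> \<open>As \<open>c \<beta>^n = - w\<close>, this \<open>r\<close> satisfies
      \<open>c \<beta>^m = - r\<close>; it will replace the top power in \<open>c\<close> times the
      first relation.\<close>
    define r where "r = w \<otimes> \<beta> [^] k"
    have rcar: "r \<in> carrier R" "\<beta> [^] k \<in> carrier R" "\<beta> [^] m' \<in> carrier R" "\<beta> [^] n \<in> carrier R"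
      using car \<beta> by (auto simp: r_def)
    have pow: "\<beta> [^] m' \<otimes> \<beta> = \<beta> [^] n \<otimes> \<beta> [^] k"
      unfolding nat_pow_mult[OF \<beta>(1)] nat_pow_Suc[symmetric]
      using m m'k(2) by (simp only:)
    have cw: "c \<otimes> \<beta> [^] n = \<ominus> w"
      using less.prems(6) car rcar by (simp add: minus_equality)
    have "c \<otimes> (a \<otimes> (\<beta> [^] m' \<otimes> \<beta>)) = a \<otimes> (c \<otimes> \<beta> [^] n) \<otimes> \<beta> [^] k"
      unfolding pow using car vcar rcar \<beta>(1) by algebra
    also have "\<dots> = \<ominus> (a \<otimes> r)"
      unfolding cw r_def using car vcar rcar \<beta>(1) by algebra
    finally have top: "c \<otimes> (a \<otimes> (\<beta> [^] m' \<otimes> \<beta>)) = \<ominus> (a \<otimes> r)" .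
    have "\<zero> = c \<otimes> (t \<oplus> u \<otimes> (v \<otimes> \<beta>))" using less.prems(3) car by simp
    also have "\<dots> = c \<otimes> t \<oplus> u \<otimes> ((c \<otimes> v') \<otimes> \<beta>) \<oplus> u \<otimes> (c \<otimes> (a \<otimes> (\<beta> [^] m' \<otimes> \<beta>)))"
      unfolding v(3) using car vcar rcar \<beta>(1) by algebra
    finally have eq: "c \<otimes> t \<oplus> u \<otimes> ((c \<otimes> v') \<otimes> \<beta>) \<oplus> u \<otimes> (\<ominus> (a \<otimes> r)) = \<zero>"
      unfolding top by simp
    \<comment> \<open>\<open>r\<close> has degree below \<open>m\<close>, so it is
      \<open>\<beta>\<close> times a value of degree below \<open>m'\<close>, plus a constant, which
      is zero as soon as \<open>k > 0\<close>.\<close>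
    have "\<exists>s b. s \<in> polyvals A \<beta> m' \<and> b \<in> A \<and> r = s \<otimes> \<beta> \<oplus> b"
    proof (cases k)
      case 0
      then show ?thesis using w m'k car unfolding r_def by auto
    next
      case (Suc k')
      have "w \<otimes> \<beta> [^] k' \<in> polyvals A \<beta> m'"
        using polyvals_shift[OF A\<beta> less.prems(5), of k'] m'k Suc n by simp
      moreover have "r = (w \<otimes> \<beta> [^] k') \<otimes> \<beta> \<oplus> \<zero>"
        unfolding r_def Suc using car \<beta>(1) by (simp add: m_assoc)
      ultimately show ?thesis using subringE(2)[OF A] by auto
    qed
    then obtain s b where s: "s \<in> polyvals A \<beta> m'" "b \<in> A" "r = s \<otimes> \<beta> \<oplus> b" by auto
    have scar: "s \<in> carrier R" "b \<in> carrier R" using s pv A_carrier by auto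
    show False
    proof (rule less.hyps[of m' n])
      show "m' + n < m + n" using m by simp
      \<comment> \<open>The constant term \<open>c t\<close> has changed only by a multiple of
        \<open>u\<close>.\<close>
      show "c \<otimes> t \<oplus> u \<otimes> (\<ominus> (a \<otimes> b)) \<in> nonvanishing"
        by (intro nonvanishing_add nonvanishing_mult less.prems subringE(5,6)[OF A] v s)
      show "c \<otimes> v' \<ominus> a \<otimes> s \<in> polyvals A \<beta> m'"
        by (intro polyvals_minus[OF A\<beta>] polyvals_scale[OF A\<beta>] tc v s)
      show "c \<otimes> t \<oplus> u \<otimes> (\<ominus> (a \<otimes> b)) \<oplus> u \<otimes> ((c \<otimes> v' \<ominus> a \<otimes> s) \<otimes> \<beta>) = \<zero>"
        unfolding eq[unfolded s(3), symmetric] using car vcar scar \<beta>(1) by algebra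
    qed (use less.prems in auto)
  next
    case False
    have v: "v \<in> polyvals A \<beta> n'"
      using polyvals_mono[OF A\<beta>, of m n'] less.prems(2) False n by auto
    \<comment> \<open>In \<open>t\<close> times the second relation minus \<open>w0\<close> times
      the first, the constant terms cancel; dividing by \<open>\<beta>\<close> leaves a relation of
      degree \<open>n'\<close> with leading coefficient \<open>t c\<close> and remainder
      \<open>w'\<close>.\<close>
    define w' where "w' = t \<otimes> w1 \<ominus> (u \<otimes> w0) \<otimes> v"
    have w': "w' \<in> polyvals A \<beta> n'"
      unfolding w'_def
      by (intro polyvals_minus[OF A\<beta>] polyvals_scale[OF A\<beta>] tc w v subringE(6)[OF A] uA)
    have car': "w' \<in> carrier R" "\<beta> [^] n' \<in> carrier R" using pv[OF w'] \<beta> by auto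
    have "((t \<otimes> c) \<otimes> \<beta> [^] n' \<oplus> w') \<otimes> \<beta>
        = t \<otimes> (c \<otimes> (\<beta> [^] n' \<otimes> \<beta>) \<oplus> (w1 \<otimes> \<beta> \<oplus> w0)) \<ominus> w0 \<otimes> (t \<oplus> u \<otimes> (v \<otimes> \<beta>))"
      unfolding w'_def using car car' wcar \<beta>(1) by algebra
    also have "\<dots> = t \<otimes> (c \<otimes> \<beta> [^] n \<oplus> w) \<ominus> w0 \<otimes> (t \<oplus> u \<otimes> (v \<otimes> \<beta>))"
      unfolding w(1) n by simp
    also have "\<dots> = \<zero>"
      unfolding less.prems(3,6) using car wcar by algebra
    finally have eq: "(t \<otimes> c) \<otimes> \<beta> [^] n' \<oplus> w' = \<zero>"
      using integral[of "(t \<otimes> c) \<otimes> \<beta> [^] n' \<oplus> w'" \<beta>] \<beta> car car' by auto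
    show False
      by (rule less.hyps[of m n' t v "t \<otimes> c" w'])
        (use less.prems n w' eq nonvanishing_mult in auto)
  qed
qed

text \<open>Otherwise \<open>A[\<beta>]\<close> would violate avoidance by maximality. Such a
  violation is a relation for \<open>\<beta>\<close> with nonvanishing constant term, incompatible
  with \<open>rel\<close>, whose leading coefficient is nonvanishing.\<close>

lemma mem_if_maximal:
  assumes max: "\<And>A'. \<lbrakk> subring A' R; A \<subseteq> A'; avoids D u A' \<rbrakk> \<Longrightarrow> A' = A"
    and \<beta>: "\<beta> \<in> carrier R"
    and rel: "c \<in> nonvanishing" "w \<in> polyvals A \<beta> n" "c \<otimes> \<beta> [^] n \<oplus> w = \<zero>"
  shows "\<beta> \<in> A"
proof (rule ccontr)
  assume notin: "\<beta> \<notin> A"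
  let ?A = "simple_extension A \<beta>"
  have "\<beta> \<in> ?A" using simple_extension_mem[OF A \<beta>] .
  moreover have "A \<subseteq> ?A" using simple_extension_incl[OF subringE(1)[OF A] \<beta>] .
  ultimately have "\<not> avoids D u ?A"
    using max[OF simple_extension_is_subring[OF A \<beta>]] notin by auto
  then obtain g where g: "g \<in> ?A" "u \<otimes> g \<in> D" "u \<otimes> g \<noteq> \<zero>"
    unfolding avoids_def by auto
  obtain k where k: "g \<in> polyvals A \<beta> k"
    using g(1) simple_extension_eq_polyvals[OF A \<beta>] by auto
  \<comment> \<open>One more degree ensures that a constant term \<open>a\<close> can be split off,
    even if \<open>k = 0\<close>.\<close>
  have "g \<in> polyvals A \<beta> (Suc k)"
    using polyvals_Suc_mono[OF A \<beta>] k by auto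
  then obtain v a where v: "g = v \<otimes> \<beta> \<oplus> a" "v \<in> polyvals A \<beta> k" "a \<in> A"
    unfolding polyvals.simps(2) by auto
  have car: "v \<in> carrier R" "a \<in> carrier R" "u \<in> carrier R"
    using v polyvals_in_carrier[OF subringE(1)[OF A] \<beta>] A_carrier u_carrier by auto
  show False
  proof (rule incompatible_relations[OF \<beta> _ _ _ _ rel])
    show "\<beta> \<noteq> \<zero>" using notin subringE(2)[OF A] by auto
    have "u \<otimes> g \<in> nonvanishing"
    proof -
      have "u \<otimes> g = u \<otimes> g \<oplus> u \<otimes> \<zero>" using v car \<beta> by simp
      then show ?thesis using g(2,3) subringE(2)[OF A] unfolding nonvanishing_def by blast
    qed
    from nonvanishing_add[OF this subringE(5)[OF A v(3)]]
    show "u \<otimes> g \<oplus> u \<otimes> (\<ominus> a) \<in> nonvanishing" .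
    show "\<ominus> v \<in> polyvals A \<beta> k" by (rule polyvals_uminus[OF A \<beta> v(2)])
    show "u \<otimes> g \<oplus> u \<otimes> (\<ominus> a) \<oplus> u \<otimes> (\<ominus> v \<otimes> \<beta>) = \<zero>"
      unfolding v(1) using car \<beta> by algebra
  qed
qed

end

section \<open>Subrings over which \<open>u\<close> is transcendental\<close>

definition (in ring) free_over :: "'a set \<Rightarrow> 'a \<Rightarrow> bool" where
  "free_over D u \<longleftrightarrow> subring D R \<and> avoids D u (simple_extension D u)"

context domain
begin

text \<open>Zorn's lemma applies because a polynomial in \<open>u\<close> over the union of a chain
  has finitely many coefficients, all in one member of the chain.\<close>

lemma ex_maximal_free_over:
  assumes "free_over D0 u" "u \<in> carrier R"
  obtains D where "free_over D u" "\<forall>D'. free_over D' u \<longrightarrow> D \<subseteq> D' \<longrightarrow> D' = D"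
proof -
  let ?F = "{D. free_over D u}"
  have "\<exists>D\<in>?F. \<forall>D'\<in>?F. D \<subseteq> D' \<longrightarrow> D' = D"
  proof (rule subset_Zorn_nonempty)
    show "?F \<noteq> {}" using assms by auto
  next
    fix C assume C: "C \<noteq> {}" "subset.chain ?F C"
    have free: "free_over E u" if "E \<in> C" for E
      using C(2) that by (auto simp: subset.chain_def)
    have "subring (\<Union>C) R"
      using chain_Union_is_subring[OF C] by (simp add: free_over_def)
    moreover have "avoids (\<Union>C) u (simple_extension (\<Union>C) u)"
      unfolding avoids_def
    proof (intro ballI impI)
      fix v assume v: "v \<in> simple_extension (\<Union>C) u" "u \<otimes> v \<in> \<Union>C"
      have chain: "\<exists>E\<in>C. E1 \<subseteq> E \<and> E2 \<subseteq> E" if "E1 \<in> C" "E2 \<in> C" for E1 E2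
      proof -
        have "E1 \<subseteq> E2 \<or> E2 \<subseteq> E1"
          using C(2) that unfolding subset.chain_def by auto
        then show ?thesis using that by auto
      qed
      have "\<exists>E\<in>C. v \<in> simple_extension E u"
        using v(1)
      proof (induction rule: simple_extension.induct)
        case zero
        then show ?case using C(1) by auto
      next
        case (lin k1 k2)
        then obtain E1 E2 where E: "E1 \<in> C" "k1 \<in> simple_extension E1 u" "E2 \<in> C" "k2 \<in> E2"
          by auto
        obtain E where "E \<in> C" "E1 \<subseteq> E" "E2 \<subseteq> E" using chain[OF E(1,3)] by auto
        then show ?case
          using simple_extension.lin[of k1 E u k2] mono_simple_extension[of E1 E u] E by auto
      qed
      then obtain E1 where E1: "E1 \<in> C" "v \<in> simple_extension E1 u" by auto
      obtain E2 where E2: "E2 \<in> C" "u \<otimes> v \<in> E2" using v(2) by auto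
      obtain E where E: "E \<in> C" "E1 \<subseteq> E" "E2 \<subseteq> E" using chain[OF E1(1) E2(1)] by auto
      have "v \<in> simple_extension E u" "u \<otimes> v \<in> E"
        using E E1 E2 mono_simple_extension[of E1 E u] by auto
      then show "u \<otimes> v = \<zero>"
        using free[OF E(1)] unfolding free_over_def avoids_def by auto
    qed
    ultimately show "\<Union>C \<in> ?F" by (simp add: free_over_def)
  qed
  then obtain D where "free_over D u" "\<forall>D'\<in>?F. D \<subseteq> D' \<longrightarrow> D' = D" by auto
  then show thesis using that by auto
qed

text \<open>Read \<open>d - u v = 0\<close> as a relation in \<open>x\<close> over
  \<open>D[u]\<close> with top coefficient \<open>e - u f\<close>, where \<open>e\<close> is in
  \<open>D\<close>. If this is zero, freeness forces \<open>e = f = 0\<close> and the degree drops;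
  \<open>d \<noteq> \<zero>\<close> stops the descent.\<close>

lemma nontrivial_relation:
  assumes "free_over D u" "u \<in> carrier R" "u \<noteq> \<zero>" "x \<in> carrier R"
  shows "\<lbrakk> d \<in> polyvals D x n; v \<in> polyvals (simple_extension D u) x n; d = u \<otimes> v; d \<noteq> \<zero> \<rbrakk>
    \<Longrightarrow> \<exists>k c w. c \<in> simple_extension D u \<and> c \<noteq> \<zero> \<and> w \<in> polyvals (simple_extension D u) x k
        \<and> c \<otimes> x [^] k \<oplus> w = \<zero>"
proof (induction n arbitrary: d v)
  case 0
  then show ?case by simp
next
  case (Suc n)
  let ?B = "simple_extension D u"
  have D: "subring D R" and av: "avoids D u ?B" using assms(1) by (auto simp: free_over_def)
  have B: "subring ?B R" by (rule simple_extension_is_subring[OF D assms(2)])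
  have DB: "D \<subseteq> ?B" by (rule simple_extension_incl[OF subringE(1)[OF D] assms(2)])
  have uB: "u \<in> ?B" by (rule simple_extension_mem[OF D assms(2)])
  have mono: "p \<in> polyvals ?B x k" if "p \<in> polyvals D x k" for p k
    using that DB by (induction k arbitrary: p) auto
  obtain d' e where d: "d' \<in> polyvals D x n" "e \<in> D" "d = d' \<oplus> e \<otimes> x [^] n"
    using polyvals_Suc_top[OF D assms(4)] Suc.prems(1) by blast
  obtain v' f where v: "v' \<in> polyvals ?B x n" "f \<in> ?B" "v = v' \<oplus> f \<otimes> x [^] n"
    using polyvals_Suc_top[OF B assms(4)] Suc.prems(2) by blast
  have car: "d' \<in> carrier R" "e \<in> carrier R" "v' \<in> carrier R" "f \<in> carrier R" "x [^] n \<in> carrier R"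
    using d v polyvals_in_carrier[OF subringE(1)[OF D] assms(4)]
      polyvals_in_carrier[OF subringE(1)[OF B] assms(4)] subringE(1)[OF D] subringE(1)[OF B] assms(4)
    by auto
  show ?case
  proof (cases "e = u \<otimes> f")
    case True
    then have "u \<otimes> f = \<zero>" using av v(2) d(2) unfolding avoids_def by auto
    then have "f = \<zero>" "e = \<zero>" using True integral[of u f] assms(2,3) car by auto
    then have "d = d'" "v = v'" using d(3) v(3) car by auto
    then show ?thesis using Suc.IH[OF d(1) v(1)] Suc.prems(3,4) by auto
  next
    case False
    have "e \<ominus> u \<otimes> f \<in> ?B"
      unfolding a_minus_def using d(2) DB v(2) uB subringE(5,6,7)[OF B] by auto
    moreover have "e \<ominus> u \<otimes> f \<noteq> \<zero>"
      using False car assms(2) by (simp add: r_right_minus_eq)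
    moreover have "d' \<ominus> u \<otimes> v' \<in> polyvals ?B x n"
      by (intro polyvals_minus[OF B assms(4)] polyvals_scale[OF B assms(4)] mono d v uB)
    moreover have "(e \<ominus> u \<otimes> f) \<otimes> x [^] n \<oplus> (d' \<ominus> u \<otimes> v') = \<zero>"
    proof -
      have "(e \<ominus> u \<otimes> f) \<otimes> x [^] n \<oplus> (d' \<ominus> u \<otimes> v') = d \<ominus> u \<otimes> v"
        unfolding d(3) v(3) using car assms(2) by algebra
      also have "\<dots> = \<zero>" unfolding Suc.prems(3) using v(3) car assms(2) by (simp add: minus_eq r_neg)
      finally show ?thesis .
    qed
    ultimately show ?thesis by auto
  qed
qed

text \<open>
  If \<open>x \<notin> D\<close>, then \<open>u\<close> is not free over \<open>D[x]\<close>; the relation witnessing this, read as a polynomial in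
  \<open>x\<close> over \<open>D[u]\<close>, is nontrivial because \<open>u\<close> is free over \<open>D\<close>.
\<close>

lemma algebraic_over_maximal_free:
  assumes free: "free_over D u" and max: "\<forall>D'. free_over D' u \<longrightarrow> D \<subseteq> D' \<longrightarrow> D' = D"
    and u: "u \<in> carrier R" "u \<noteq> \<zero>" and x: "x \<in> carrier R"
  shows "\<exists>k c w. c \<in> simple_extension D u \<and> c \<noteq> \<zero> \<and> w \<in> polyvals (simple_extension D u) x k
        \<and> c \<otimes> x [^] (k::nat) \<oplus> w = \<zero>"
proof -
  let ?B = "simple_extension D u"
  have D: "subring D R" and av: "avoids D u ?B" using free by (auto simp: free_over_def)
  have B: "subring ?B R" by (rule simple_extension_is_subring[OF D u(1)])
  have DB: "D \<subseteq> ?B" by (rule simple_extension_incl[OF subringE(1)[OF D] u(1)])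
  show ?thesis
  proof (cases "x \<in> D")
    case True
    have "\<ominus> x \<in> polyvals ?B x 1"
      using polyvals_const[OF B x, of "\<ominus> x" 0] subringE(5)[OF B] True DB by auto
    moreover have "\<one> \<otimes> x [^] (1::nat) \<oplus> \<ominus> x = \<zero>" using x by (simp add: r_neg)
    ultimately show ?thesis using subringE(3)[OF B] one_not_zero by blast
  next
    case False
    let ?D = "simple_extension D x"
    have D': "subring ?D R" by (rule simple_extension_is_subring[OF D x])
    have "x \<in> ?D" "D \<subseteq> ?D"
      using simple_extension_mem[OF D x] simple_extension_incl[OF subringE(1)[OF D] x] by auto
    then have "\<not> avoids ?D u (simple_extension ?D u)"
      using max D' False unfolding free_over_def by auto
    then obtain v where v: "v \<in> simple_extension ?D u" "u \<otimes> v \<in> ?D" "u \<otimes> v \<noteq> \<zero>"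
      unfolding avoids_def by auto
    have Bx: "subring (simple_extension ?B x) R"
      by (rule simple_extension_is_subring[OF B x])
    have B_sub: "?B \<subseteq> simple_extension ?B x"
      by (rule simple_extension_incl[OF subringE(1)[OF B] x])
    have "simple_extension ?D u \<subseteq> simple_extension ?B x"
      by (rule simple_extension_subring_incl[OF Bx])
        (use mono_simple_extension[OF DB] B_sub simple_extension_mem[OF D u(1)] in auto)
    then obtain k where k: "v \<in> polyvals ?B x k"
      using v(1) simple_extension_eq_polyvals[OF B x] by auto
    obtain l where l: "u \<otimes> v \<in> polyvals D x l"
      using v(2) simple_extension_eq_polyvals[OF D x] by auto
    have "v \<in> polyvals ?B x (max k l)" "u \<otimes> v \<in> polyvals D x (max k l)"
      using k l polyvals_mono[OF B x, of k "max k l"] polyvals_mono[OF D x, of l "max k l"] by auto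
    then show ?thesis
      using nontrivial_relation[OF free u x _ _ refl v(3)] by blast
  qed
qed

text \<open>Each \<open>x\<close> is algebraic over \<open>D[u]\<close>, and the leading coefficient
  of its relation is a power of \<open>u\<close> times a nonvanishing element. Hence some
  \<open>u^k x\<close> satisfies the hypotheses of \<open>mem_if_maximal\<close>, and
  \<open>A\<close> and \<open>inv u\<close> generate \<open>R\<close>.\<close>

lemma submaximal_if_free_unit:
  assumes "free_over D0 u" and u: "u \<in> Units R"
  shows "submaximal R"
proof -
  have uc: "u \<in> carrier R" "u \<noteq> \<zero>" using u by (auto simp: Units_def)
  obtain D where free: "free_over D u" and maxD: "\<forall>D'. free_over D' u \<longrightarrow> D \<subseteq> D' \<longrightarrow> D' = D"
    using ex_maximal_free_over[OF assms(1) uc(1)] by blast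
  let ?B = "simple_extension D u"
  have D: "subring D R" and avB: "avoids D u ?B" using free by (auto simp: free_over_def)
  have B: "subring ?B R" by (rule simple_extension_is_subring[OF D uc(1)])
  have DB: "D \<subseteq> ?B" by (rule simple_extension_incl[OF subringE(1)[OF D] uc(1)])
  have uB: "u \<in> ?B" by (rule simple_extension_mem[OF D uc(1)])
  let ?F = "{A. subring A R \<and> ?B \<subseteq> A \<and> avoids D u A}"
  have "\<exists>A\<in>?F. \<forall>A'\<in>?F. A \<subseteq> A' \<longrightarrow> A' = A"
  proof (rule subset_Zorn_nonempty)
    show "?F \<noteq> {}" using B avB by auto
  next
    fix C assume C: "C \<noteq> {}" "subset.chain ?F C"
    then have sub: "C \<subseteq> ?F" by (simp add: subset.chain_def)
    have "subring (\<Union>C) R" using chain_Union_is_subring[OF C] by simp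
    moreover have "?B \<subseteq> \<Union>C" using sub C(1) by auto
    moreover have "avoids D u (\<Union>C)" using sub unfolding avoids_def by auto
    ultimately show "\<Union>C \<in> ?F" by simp
  qed
  then obtain A where A: "subring A R" "?B \<subseteq> A" "avoids D u A"
    and maxA: "\<forall>A'\<in>?F. A \<subseteq> A' \<longrightarrow> A' = A" by auto
  interpret ext: avoiding_extension R D A u
    by (intro avoiding_extension.intro avoiding_extension_axioms.intro domain_axioms A D)
      (use A(2) DB uB in auto)
  have inv: "inv u \<in> carrier R" "u \<otimes> inv u = \<one>" "inv u \<otimes> u = \<one>" using u by auto
  \<comment> \<open>Factors \<open>u\<close> are pulled out as long as the constant coefficient is
    zero.\<close>
  have u_power_factor: "\<exists>k c'. c' \<in> ext.nonvanishing \<and> c = u [^] (k::nat) \<otimes> c'" if "c \<in> ?B" "c \<noteq> \<zero>" for c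
    using that
  proof (induction rule: simple_extension.induct)
    case (lin b d)
    have car: "b \<in> carrier R" "d \<in> carrier R"
      using lin(1,2) subringE(1)[OF B] subringE(1)[OF D] by auto
    show ?case
    proof (cases "d = \<zero>")
      case True
      then have "b \<noteq> \<zero>" using lin(4) car uc by auto
      then obtain k c' where k: "c' \<in> ext.nonvanishing" "b = u [^] (k::nat) \<otimes> c'" using lin(3) by auto
      have "c' \<in> carrier R" using k(1) ext.nonvanishing_subset ext.A_carrier by auto
      then have "b \<otimes> u \<oplus> d = u [^] (Suc k) \<otimes> c'"
        using True uc(1) unfolding k(2) by (simp add: m_ac)
      then show ?thesis using k(1) by blast
    next
      case False
      have "b \<otimes> u \<oplus> d = d \<oplus> u \<otimes> b" using car uc(1) by algebra
      then have "b \<otimes> u \<oplus> d \<in> ext.nonvanishing" using False lin(1,2) A(2) unfolding ext.nonvanishing_def by auto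
      moreover have "b \<otimes> u \<oplus> d = u [^] (0::nat) \<otimes> (b \<otimes> u \<oplus> d)" using car uc(1) by simp
      ultimately show ?thesis by blast
    qed
  qed simp
  have absorb: "\<exists>k. u [^] (k::nat) \<otimes> x \<in> A" if x: "x \<in> carrier R" for x
  proof -
    obtain n c w where rel: "c \<in> ?B" "c \<noteq> \<zero>" "w \<in> polyvals ?B x n" "c \<otimes> x [^] (n::nat) \<oplus> w = \<zero>"
      using algebraic_over_maximal_free[OF free maxD uc x] by (elim exE conjE)
    obtain k c' where c': "c' \<in> ext.nonvanishing" "c = u [^] (k::nat) \<otimes> c'" using u_power_factor rel(1,2) by blast
    define y where "y = u [^] k"
    have y: "y \<in> carrier R" "y \<in> ?B"
      using uc(1) uB subringE(3,6)[OF B] unfolding y_def by (simp, induction k) auto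
    have car: "c \<in> carrier R" "c' \<in> carrier R" "w \<in> carrier R"
      using rel(1) subringE(1)[OF B] c'(1) ext.nonvanishing_subset ext.A_carrier
        polyvals_in_carrier[OF subringE(1)[OF B] x, of n] rel(3) by auto
    have "n \<noteq> 0" using rel(2-4) car by (intro notI) simp
    then obtain m where n: "n = Suc m" by (cases n) auto
    have "y [^] m \<otimes> w \<in> polyvals ?B (y \<otimes> x) n"
      using polyvals_rescale[OF B x y(2)] rel(3) n by auto
    moreover have "p \<in> polyvals A z l" if "p \<in> polyvals ?B z l" for p z l
      using that A(2) by (induction l arbitrary: p) auto
    ultimately have w': "y [^] m \<otimes> w \<in> polyvals A (y \<otimes> x) n" by auto
    \<comment> \<open>With \<open>n = Suc m\<close> and \<open>c = y c'\<close>, the factor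
      \<open>y\<close> of the leading coefficient completes \<open>y^m\<close> to
      \<open>y^n\<close>, leaving \<open>c'\<close> in front of \<open>(y x)^n\<close>.\<close>
    have "c' \<otimes> (y \<otimes> x) [^] n \<oplus> y [^] m \<otimes> w = y [^] m \<otimes> (c \<otimes> x [^] n \<oplus> w)"
    proof -
      have p: "y [^] m \<in> carrier R" "x [^] n \<in> carrier R" using y x by auto
      have "(y \<otimes> x) [^] n = (y [^] m \<otimes> y) \<otimes> x [^] n"
        unfolding n nat_pow_Suc[of y, symmetric] by (rule nat_pow_distrib[OF y(1) x])
      then show ?thesis
        using p car y(1) x unfolding c'(2) y_def[symmetric] by algebra
    qed
    then have "c' \<otimes> (y \<otimes> x) [^] n \<oplus> y [^] m \<otimes> w = \<zero>"
      using rel(4) y(1) by simp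
    then have "y \<otimes> x \<in> A"
      using ext.mem_if_maximal[OF _ _ c'(1) w'] maxA A(2) y(1) x by auto
    then show ?thesis unfolding y_def by blast
  qed
  show ?thesis
  proof (rule submaximalI[OF A(1) inv(1)])
    \<comment> \<open>Otherwise \<open>\<one> = u \<otimes> inv u\<close> would be a nonzero element
      of \<open>D \<inter> u A\<close>.\<close>
    show "inv u \<notin> A"
      using A(3) inv(2) subringE(3)[OF D] one_not_zero unfolding avoids_def by auto
  next
    fix S assume S: "subring S R" "A \<subseteq> S" "inv u \<in> S"
    have "x \<in> S" if x: "x \<in> carrier R" for x
    proof -
      obtain k where k: "u [^] (k::nat) \<otimes> x \<in> A" using absorb[OF x] by blast
      have "inv u [^] k \<in> S" using subringE(3,6)[OF S(1)] S(3) by (induction k) auto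
      then have "inv u [^] k \<otimes> (u [^] k \<otimes> x) \<in> S"
        using subringE(6)[OF S(1)] S(2) k by auto
      moreover have "inv u [^] k \<otimes> (u [^] k \<otimes> x) = (inv u \<otimes> u) [^] k \<otimes> x"
        using inv(1) uc(1) x by (simp add: nat_pow_distrib m_assoc)
      ultimately show ?thesis using inv(3) x by simp
    qed
    then show "S = carrier R" using subringE(1)[OF S(1)] by auto
  qed
qed

end

subsection \<open>Uncountable factorial domains\<close>

lemma (in cring) mem_cgenideal_iff_divides:
  assumes "p \<in> carrier R"
  shows "f \<in> PIdl p \<longleftrightarrow> p divides f"
proof -
  have "f \<in> PIdl p \<longleftrightarrow> (\<exists>c\<in>carrier R. f = c \<otimes> p)"
    unfolding cgenideal_def by blast
  also have "\<dots> \<longleftrightarrow> p divides f"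
    unfolding factor_def using m_comm[OF assms] by (intro bex_cong refl) simp
  finally show ?thesis .
qed

section \<open>Countable subrings and the elements that are not free over them\<close>

lemma (in ring) exists_countable_subring: "\<exists>Z. subring Z R \<and> countable Z"
proof -
  \<comment> \<open>The prime subring, that is, the image of the integers.\<close>
  define Z where "Z = range (\<lambda>k::int. [k] \<cdot> \<one>)"
  have "subring Z R"
  proof (rule subringI)
    show "Z \<subseteq> carrier R" by (auto simp: Z_def)
    have "\<one> = [(1::int)] \<cdot> \<one>" by simp
    then show "\<one> \<in> Z" unfolding Z_def by (rule range_eqI)
  next
    fix h assume "h \<in> Z"
    then obtain k where "h = [(k::int)] \<cdot> \<one>" by (auto simp: Z_def)
    then have "\<ominus> h = [(- k)] \<cdot> \<one>" using add.int_pow_neg[OF one_closed, of k] by simp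
    then show "\<ominus> h \<in> Z" unfolding Z_def by (rule range_eqI)
  next
    fix h1 h2 assume "h1 \<in> Z" "h2 \<in> Z"
    then obtain k l where kl: "h1 = [(k::int)] \<cdot> \<one>" "h2 = [(l::int)] \<cdot> \<one>" by (auto simp: Z_def)
    have "h1 \<oplus> h2 = [(k + l)] \<cdot> \<one>" using add.int_pow_mult[OF one_closed, of k l] kl by simp
    then show "h1 \<oplus> h2 \<in> Z" unfolding Z_def by (rule range_eqI)
    have "h1 \<otimes> h2 = [k] \<cdot> ([l] \<cdot> \<one>)" using kl by (simp add: add_pow_ldistr_int)
    then have "h1 \<otimes> h2 = [(l * k)] \<cdot> \<one>" using add.int_pow_pow[OF one_closed, of k l] by simp
    then show "h1 \<otimes> h2 \<in> Z" unfolding Z_def by (rule range_eqI)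
  qed
  moreover have "countable Z" by (simp add: Z_def)
  ultimately show ?thesis by auto
qed

lemma (in ring) countable_simple_extension:
  assumes "subring Z R" "countable Z" "x \<in> carrier R"
  shows "countable (simple_extension Z x)"
proof -
  have "carrier (Z[X]) \<subseteq> lists Z"
    by (auto simp: univ_poly_carrier[symmetric] dest!: polynomial_incl)
  then have "countable (carrier (Z[X]))"
    by (rule countable_subset) (simp add: assms(2))
  then show ?thesis
    unfolding simple_extension_as_eval_img[OF subringE(1)[OF assms(1)] assms(3)] by simp
qed

text \<open>An element \<open>u\<close> that is not free is a root of some nonzero polynomial
  \<open>p X - u v\<close> with coefficients in \<open>Z\<close>. There are countably many such
  polynomials, each with finitely many roots.\<close>

lemma (in domain) countable_not_free_over:
  assumes Z: "subring Z R" "countable Z"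
  shows "countable {u \<in> carrier R. \<not> free_over Z u}"
proof -
  let ?P = "carrier (poly_ring R) \<inter> lists Z"
  have "{u \<in> carrier R. \<not> free_over Z u} \<subseteq> (\<Union>p\<in>?P. {u. is_root p u})"
  proof
    fix u assume "u \<in> {u \<in> carrier R. \<not> free_over Z u}"
    then have u: "u \<in> carrier R" "\<not> avoids Z u (simple_extension Z u)"
      using Z(1) by (auto simp: free_over_def)
    then obtain v where v: "v \<in> simple_extension Z u" "u \<otimes> v \<in> Z" "u \<otimes> v \<noteq> \<zero>"
      unfolding avoids_def by auto
    obtain p where p: "p \<in> carrier (Z[X])" "v = eval p u"
      using v(1) simple_extension_as_eval_img[OF subringE(1)[OF Z(1)] u(1)] by auto
    have poly: "polynomial Z p" using p(1) by (simp add: univ_poly_carrier)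
    have pZ: "set p \<subseteq> Z" by (rule polynomial_incl[OF poly])
    have vc: "v \<in> carrier R"
      using v(1) simple_extension_in_carrier[OF subringE(1)[OF Z(1)] u(1)] by auto
    have d: "\<ominus> (u \<otimes> v) \<in> Z" "\<ominus> (u \<otimes> v) \<noteq> \<zero>"
      using subringE(5)[OF Z(1) v(2)] v(3) u(1) vc by auto
    \<comment> \<open>Coefficient lists begin with the leading coefficient, so appending multiplies
      by \<open>X\<close> and adds a constant. As that constant is nonzero, the list is normalized
      even for empty \<open>p\<close>.\<close>
    let ?q = "p @ [\<ominus> (u \<otimes> v)]"
    have qZ: "set ?q \<subseteq> Z" using pZ d by auto
    have "lead_coeff ?q \<noteq> \<zero>"
      using poly d(2) unfolding polynomial_def by (cases p) auto
    then have "polynomial (carrier R) ?q"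
      using qZ subringE(1)[OF Z(1)] unfolding polynomial_def by auto
    then have "?q \<in> ?P" using qZ by (auto simp: univ_poly_carrier)
    moreover have "eval ?q u = v \<otimes> u \<oplus> \<ominus> (u \<otimes> v)"
      using eval_append_aux[of p "\<ominus> (u \<otimes> v)" u] p(2) pZ subringE(1)[OF Z(1)] u(1) vc by auto
    then have "is_root ?q u"
      using u(1) vc unfolding is_root_def by (simp add: m_comm r_neg)
    ultimately show "u \<in> (\<Union>p\<in>?P. {u. is_root p u})" by (intro UN_I) auto
  qed
  moreover have "countable (\<Union>p\<in>?P. {u. is_root p u})"
  proof (rule countable_UN)
    show "countable ?P" using countable_subset[of ?P "lists Z"] Z(2) by simp
    show "\<And>p. p \<in> ?P \<Longrightarrow> countable {u. is_root p u}"
      using finite_number_of_roots by (auto intro: countable_finite)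
  qed
  ultimately show ?thesis by (rule countable_subset)
qed

section \<open>Prime factors and divisors in a factorial domain\<close>

context factorial_domain
begin

text \<open>Induction on a list of irreducible factors, which are prime in a factorial
  domain.\<close>

lemma prime_induct [consumes 1, case_names unit prime]:
  assumes a: "a \<in> carrier R - {\<zero>}"
    and unit: "\<And>a. a \<in> Units R \<Longrightarrow> P a"
    and prime: "\<And>p a. \<lbrakk> p \<in> carrier R; ring_prime p; a \<in> carrier R - {\<zero>}; P a \<rbrakk> \<Longrightarrow> P (p \<otimes> a)"
  shows "P a"
proof (cases "a \<in> Units R")
  case False
  obtain fs where fs: "set fs \<subseteq> carrier (mult_of R)" "factors (mult_of R) fs a"
    using factors_exist[of a] a False by auto
  have "\<lbrakk> set gs \<subseteq> carrier R - {\<zero>}; \<forall>x\<in>set gs. irreducible (mult_of R) x \<rbrakk>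
    \<Longrightarrow> foldr (\<otimes>) gs \<one> \<in> carrier R - {\<zero>} \<and> P (foldr (\<otimes>) gs \<one>)" for gs
  proof (induction gs)
    case Nil
    then show ?case using unit by simp
  next
    case (Cons x gs)
    have x: "x \<in> carrier R - {\<zero>}" "irreducible (mult_of R) x" using Cons.prems by auto
    then have "ring_prime x"
      using ring_primeI'[OF x(1)] irreducible_prime[of x] by auto
    then show ?case
      using Cons x prime[of x "foldr (\<otimes>) gs \<one>"] integral[of x "foldr (\<otimes>) gs \<one>"] by auto
  qed
  then show ?thesis using fs unfolding factors_def by auto
qed (rule unit)

lemma prime_dvd_cases:
  assumes p: "p \<in> carrier R" "ring_prime p" and car: "a \<in> carrier R" "b \<in> carrier R" "c \<in> carrier R"
    and eq: "p \<otimes> a = b \<otimes> c"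
  shows "(\<exists>b'\<in>carrier R. b = p \<otimes> b' \<and> a = b' \<otimes> c) \<or> (\<exists>c'\<in>carrier R. c = p \<otimes> c' \<and> a = b \<otimes> c')"
proof -
  have p0: "p \<noteq> \<zero>" and "prime R p" using ring_primeE[OF p] by auto
  moreover have "p divides b \<otimes> c" using eq car(1) by (metis dividesI)
  ultimately have "p divides b \<or> p divides c" using car(2,3) unfolding prime_def by auto
  then show ?thesis
  proof
    assume "p divides b"
    then obtain b' where b': "b' \<in> carrier R" "b = p \<otimes> b'" unfolding factor_def by auto
    then have "p \<otimes> a = p \<otimes> (b' \<otimes> c)" using eq p car by (simp add: m_assoc)
    then have "a = b' \<otimes> c" using m_lcancel[OF p0 p(1)] car b' by simp
    then show ?thesis using b' by auto
  next
    assume "p divides c"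
    then obtain c' where c': "c' \<in> carrier R" "c = p \<otimes> c'" unfolding factor_def by auto
    then have "p \<otimes> a = p \<otimes> (b \<otimes> c')" using eq p car by (simp add: m_lcomm)
    then have "a = b \<otimes> c'" using m_lcancel[OF p0 p(1)] car c' by simp
    then show ?thesis using c' by auto
  qed
qed

text \<open>A divisor of \<open>p a\<close> is a divisor of \<open>a\<close> or \<open>p\<close>
  times one, so each prime factor at most doubles the divisors; the divisors of a unit are
  units.\<close>

lemma countable_divisors:
  assumes "countable (Units R)" and "a \<in> carrier R - {\<zero>}"
  shows "countable {b \<in> carrier R. b divides a}"
  using assms(2)
proof (induction a rule: prime_induct)
  case (unit a)
  have "{b \<in> carrier R. b divides a} \<subseteq> Units R"
    using unit divides_unit by auto
  then show ?case using assms(1) countable_subset by blast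
next
  case (prime p a)
  let ?D = "{b \<in> carrier R. b divides a}"
  have "{b \<in> carrier R. b divides (p \<otimes> a)} \<subseteq> ?D \<union> (\<otimes>) p ` ?D"
  proof
    fix b assume "b \<in> {b \<in> carrier R. b divides (p \<otimes> a)}"
    then obtain c where bc: "b \<in> carrier R" "c \<in> carrier R" "p \<otimes> a = b \<otimes> c"
      unfolding factor_def by auto
    then consider b' where "b' \<in> carrier R" "b = p \<otimes> b'" "a = b' \<otimes> c"
      | c' where "c' \<in> carrier R" "a = b \<otimes> c'"
      using prime_dvd_cases[of p a b c] prime by auto
    then show "b \<in> ?D \<union> (\<otimes>) p ` ?D"
      using bc by cases (auto intro: dividesI)
  qed
  moreover have "countable (?D \<union> (\<otimes>) p ` ?D)" using prime by simp
  ultimately show ?case by (rule countable_subset)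
qed

text \<open>If \<open>p\<close> divides \<open>f\<close> and \<open>a\<close> divides
  \<open>g\<close>, then \<open>p a\<close> divides \<open>f g\<close>, which is again nonzero and
  in \<open>W\<close>. Used contrapositively, to find a prime factor dividing no nonzero element of
  \<open>W\<close>.\<close>

lemma divides_nonzero_subring_elem:
  assumes W: "subring W R"
    and primes: "\<And>p. \<lbrakk> p \<in> carrier R; ring_prime p; p divides d \<rbrakk> \<Longrightarrow> \<exists>f\<in>W - {\<zero>}. p divides f"
    and d: "d \<in> carrier R - {\<zero>}"
  shows "\<exists>f\<in>W - {\<zero>}. d divides f"
  using d primes
proof (induction d rule: prime_induct)
  case (unit a)
  then have "a divides \<one>" by (auto simp: Units_def intro: dividesI)
  then show ?case using subringE(3)[OF W] one_not_zero by auto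
next
  case (prime p a)
  have "p divides (p \<otimes> a)" using prime(3) by (auto intro: dividesI)
  then obtain f where f: "f \<in> W - {\<zero>}" "p divides f" using prime by auto
  have "\<exists>g\<in>W - {\<zero>}. a divides g"
  proof (rule prime.IH)
    fix q assume q: "q \<in> carrier R" "ring_prime q" "q divides a"
    have "a divides (p \<otimes> a)" using prime(1,3) by (auto intro: dividesI simp: m_comm)
    then have "q divides (p \<otimes> a)" using q divides_trans by blast
    then show "\<exists>f\<in>W - {\<zero>}. q divides f" using prime.prems q by auto
  qed
  then obtain g where g: "g \<in> W - {\<zero>}" "a divides g" by auto
  obtain s t where st: "s \<in> carrier R" "f = p \<otimes> s" "t \<in> carrier R" "g = a \<otimes> t"
    using f(2) g(2) unfolding factor_def by auto
  have "f \<otimes> g = (p \<otimes> a) \<otimes> (s \<otimes> t)"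
    unfolding st(2,4) using st prime(1,3) by (simp add: m_ac)
  then have "(p \<otimes> a) divides (f \<otimes> g)" using st by (auto intro: dividesI)
  moreover have "f \<otimes> g \<in> W - {\<zero>}"
    using f(1) g(1) subringE(1,6)[OF W] integral[of f g] by auto
  ultimately show ?case by auto
qed

end

section \<open>Free units in a quotient domain\<close>

lemma (in ring_hom_ring) free_over_image:
  assumes "domain R" "ring.free_over R Z x" "x \<in> carrier R"
    and inj: "\<And>f. \<lbrakk> f \<in> ring.simple_extension R Z x; h f = \<zero>\<^bsub>S\<^esub> \<rbrakk> \<Longrightarrow> f = \<zero>"
  shows "ring.free_over S (h ` Z) (h x)"
proof -
  interpret R: domain R by fact
  have Z: "subring Z R" and av: "R.avoids Z x (R.simple_extension Z x)"
    using assms(2) unfolding R.free_over_def by auto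
  let ?W = "R.simple_extension Z x"
  have W: "subring ?W R" by (rule R.simple_extension_is_subring[OF Z assms(3)])
  have ZW: "Z \<subseteq> ?W" by (rule R.simple_extension_incl[OF subringE(1)[OF Z] assms(3)])
  have xW: "x \<in> ?W" by (rule R.simple_extension_mem[OF Z assms(3)])
  have Wc: "w \<in> carrier R" if "w \<in> ?W" for w using subringE(1)[OF W] that by auto
  have "S.avoids (h ` Z) (h x) (S.simple_extension (h ` Z) (h x))"
    unfolding S.avoids_def
  proof (intro ballI impI)
    fix v assume v: "v \<in> S.simple_extension (h ` Z) (h x)" "h x \<otimes>\<^bsub>S\<^esub> v \<in> h ` Z"
    \<comment> \<open>Lift the relation to \<open>Z[x]\<close>: there \<open>x w - z\<close> lies in
      the kernel, so it is zero by \<open>inj\<close>, and freeness of \<open>x\<close>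
      applies.\<close>
    have "\<exists>w\<in>?W. v = h w"
      using v(1)
    proof (induction rule: S.simple_extension.induct)
      case zero
      then show ?case using subringE(2)[OF W] by (intro bexI[of _ \<zero>]) auto
    next
      case (lin k1 k2)
      then obtain w z where wz: "w \<in> ?W" "k1 = h w" "z \<in> Z" "k2 = h z" by auto
      then have "k1 \<otimes>\<^bsub>S\<^esub> h x \<oplus>\<^bsub>S\<^esub> k2 = h (w \<otimes> x \<oplus> z)"
        using Wc ZW assms(3) by auto
      moreover have "w \<otimes> x \<oplus> z \<in> ?W" using wz by (intro R.simple_extension.lin)
      ultimately show ?case by auto
    qed
    then obtain w where w: "w \<in> ?W" "v = h w" by auto
    obtain z where z: "z \<in> Z" "h x \<otimes>\<^bsub>S\<^esub> v = h z" using v(2) by auto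
    have car: "w \<in> carrier R" "z \<in> carrier R" using w z Wc ZW by auto
    have "x \<otimes> w \<ominus> z \<in> ?W"
      unfolding R.minus_eq using w z xW ZW subringE(5-7)[OF W] by auto
    moreover have "h (x \<otimes> w \<ominus> z) = \<zero>\<^bsub>S\<^esub>"
      using z(2) w(2) car assms(3) by (simp add: R.minus_eq S.r_neg)
    ultimately have "x \<otimes> w \<ominus> z = \<zero>" by (rule inj)
    then have "x \<otimes> w = z" using car assms(3) by simp
    then have "x \<otimes> w = \<zero>" using av w(1) z(1) unfolding R.avoids_def by auto
    then show "h x \<otimes>\<^bsub>S\<^esub> v = \<zero>\<^bsub>S\<^esub>"
      using \<open>x \<otimes> w = z\<close> z(2) by simp
  qed
  then show ?thesis
    unfolding S.free_over_def using img_is_subring[OF Z] by simp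
qed

text \<open>By \<open>unit\<close>, the image of \<open>y\<close> inverts that of \<open>x\<close>,
  which stays free by \<open>inj\<close>. So \<open>S\<close> has a maximal subring, whose inverse
  image is one of \<open>R\<close>.\<close>

lemma (in ring_hom_ring) submaximal_if_vimage_free_unit:
  assumes "domain R" "domain S" and surj: "h ` carrier R = carrier S"
    and free: "ring.free_over R Z x" and x: "x \<in> carrier R" and y: "y \<in> carrier R"
    and unit: "h (\<one> \<ominus> x \<otimes> y) = \<zero>\<^bsub>S\<^esub>"
    and inj: "\<And>f. \<lbrakk> f \<in> ring.simple_extension R Z x; h f = \<zero>\<^bsub>S\<^esub> \<rbrakk> \<Longrightarrow> f = \<zero>"
  shows "submaximal R"
proof -
  interpret S: domain S by fact
  have "\<one>\<^bsub>S\<^esub> \<ominus>\<^bsub>S\<^esub> h x \<otimes>\<^bsub>S\<^esub> h y = \<zero>\<^bsub>S\<^esub>"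
    using unit x y by (simp add: R.minus_eq S.minus_eq)
  then have "h x \<otimes>\<^bsub>S\<^esub> h y = \<one>\<^bsub>S\<^esub>" using x y by simp
  then have "h x \<in> Units S"
    using x y S.m_comm[of "h x" "h y"] unfolding Units_def by auto
  moreover have "ring.free_over S (h ` Z) (h x)"
    by (rule free_over_image[OF assms(1) free x inj])
  ultimately show ?thesis
    by (intro submaximal_vimage[OF surj] S.submaximal_if_free_unit)
qed

lemma (in factorial_domain) submaximal_if_uncountable:
  assumes "uncountable (carrier R)"
  shows "submaximal R"
proof -
  obtain Z where Z: "subring Z R" "countable Z" using exists_countable_subring by auto
  show ?thesis
  proof (cases "countable (Units R)")
    case False
    have "\<not> Units R \<subseteq> {u \<in> carrier R. \<not> free_over Z u}"
      using countable_subset[OF _ countable_not_free_over[OF Z]] False by auto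
    then obtain u where "u \<in> Units R" "free_over Z u" by auto
    then show ?thesis using submaximal_if_free_unit by auto
  next
    case True
    \<comment> \<open>The divisors of nonzero elements of \<open>W\<close>: a countable set for
      countable \<open>W\<close>, so uncountably many elements of \<open>R\<close> lie
      outside.\<close>
    define divs where "divs W = (\<Union>f\<in>W - {\<zero>}. {b \<in> carrier R. b divides f})" for W
    have divs: "countable (divs W)" if "subring W R" "countable W" for W
      unfolding divs_def
      by (intro countable_UN countable_Diff that countable_divisors[OF True])
        (use subringE(1)[OF that(1)] in auto)
    have "\<not> carrier R \<subseteq> divs Z \<union> {\<zero>}"
      using countable_subset[of "carrier R" "divs Z \<union> {\<zero>}"] divs[OF Z] assms by auto
    then obtain x where x: "x \<in> carrier R" "x \<noteq> \<zero>" "x \<notin> divs Z" by auto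
    let ?W = "simple_extension Z x"
    have W: "subring ?W R" "countable ?W"
      using simple_extension_is_subring[OF Z(1) x(1)] countable_simple_extension[OF Z x(1)] by auto
    \<comment> \<open>A nonzero \<open>x a\<close> in \<open>Z\<close> would be a nonzero element of
      \<open>Z\<close> divisible by \<open>x\<close>.\<close>
    have "avoids Z x ?W"
      using x(1,3) subringE(1)[OF W(1)] unfolding avoids_def divs_def by (auto intro: dividesI)
    then have free: "free_over Z x" using Z(1) by (simp add: free_over_def)
    let ?g = "\<lambda>y. \<one> \<ominus> x \<otimes> y"
    \<comment> \<open>Injectivity makes the values \<open>1 - x y\<close> uncountable in number, so
      one of them is nonzero and outside \<open>divs ?W\<close>.\<close>
    have "inj_on ?g (carrier R)"
    proof (rule inj_onI)
      fix y z assume yz: "y \<in> carrier R" "z \<in> carrier R" "?g y = ?g z"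
      have "x \<otimes> y = \<one> \<ominus> ?g y" using x(1) yz(1) by algebra
      also have "\<dots> = x \<otimes> z" unfolding yz(3) using x(1) yz(2) by algebra
      finally show "y = z" using m_lcancel[OF x(2,1)] yz by auto
    qed
    then have "uncountable (?g ` carrier R)"
      using assms countable_image_inj_eq by blast
    then have "\<not> ?g ` carrier R \<subseteq> divs ?W \<union> {\<zero>}"
      using countable_subset[of _ "divs ?W \<union> {\<zero>}"] divs[OF W] by auto
    then obtain y where y: "y \<in> carrier R" "?g y \<notin> divs ?W" "?g y \<noteq> \<zero>" by auto
    have gc: "?g y \<in> carrier R" using x(1) y(1) by simp
    then have "\<not> (\<exists>f\<in>?W - {\<zero>}. ?g y divides f)"
      using y(2) unfolding divs_def by auto
    then have "\<exists>p\<in>carrier R. ring_prime p \<and> p divides ?g y \<and> \<not> (\<exists>f\<in>?W - {\<zero>}. p divides f)"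
      using divides_nonzero_subring_elem[OF W(1), of "?g y"] gc y(3) by (metis Diff_iff singletonD)
    then obtain p where p: "p \<in> carrier R" "ring_prime p" "p divides ?g y"
        and p_W: "\<not> (\<exists>f\<in>?W - {\<zero>}. p divides f)"
      by auto
    have p0: "p \<in> carrier R - {\<zero>}" using p ring_primeE(1) by auto
    interpret P: primeideal "PIdl p" R
      using primeideal_iff_prime[OF p0] p(2) by simp
    let ?Q = "R Quot (PIdl p)" and ?h = "(+>) (PIdl p)"
    have Q: "domain ?Q" by (rule P.quotient_is_domain)
    have h0: "?h f = \<zero>\<^bsub>?Q\<^esub> \<longleftrightarrow> p divides f" if f: "f \<in> carrier R" for f
    proof -
      have "?h f = \<zero>\<^bsub>?Q\<^esub> \<longleftrightarrow> ?h f = PIdl p"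
        by (simp add: FactRing_def)
      also have "\<dots> \<longleftrightarrow> f \<in> PIdl p"
        by (rule iffI[OF P.rcos_const_imp_mem[OF f] P.a_rcos_const])
      also have "\<dots> \<longleftrightarrow> p divides f" by (rule mem_cgenideal_iff_divides[OF p(1)])
      finally show ?thesis .
    qed
    show ?thesis
    proof (rule ring_hom_ring.submaximal_if_vimage_free_unit[OF P.rcos_ring_hom_ring domain_axioms Q
          _ free x(1) y(1)])
      show "?h ` carrier R = carrier ?Q"
        by (auto simp: FactRing_def A_RCOSETS_def')
      show "?h (?g y) = \<zero>\<^bsub>?Q\<^esub>" using h0[OF gc] p(3) by simp
      \<comment> \<open>The kernel consists of the multiples of \<open>p\<close>, and by the choice
        of \<open>p\<close> it meets \<open>Z[x]\<close> only in zero.\<close>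
      show "f = \<zero>" if "f \<in> ?W" "?h f = \<zero>\<^bsub>?Q\<^esub>" for f
        using h0[of f] that p_W subringE(1)[OF W(1)] by auto
    qed
  qed
qed

theorem theorem2p1:
  fixes R :: "('a, 'b) ring_scheme"
  assumes "factorial_domain R"
    and "uncountable (carrier R)"
  shows "submaximal R"
  using assms by (rule factorial_domain.submaximal_if_uncountable)

end
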